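(* The space $\omega_1$, consisting of all countable ordinals with the order topology, is Stäckel-compact. Thus there are Stäckel-compact spaces which are not compact.
   Context: Work in ZFC. A Hausdorff topological space $X$ is Stäckel-compact if there is a linear (total) order $\prec$ on the set $X$ such that every non-empty closed subset of $X$ has a $\prec$-least and a $\prec$-greatest element; $\prec$ is not assumed to be related to the topology of $X$ in any other way (in particular, for $\omega_1$, $\prec$ need not be the usual ordering of the ordinals). *)

theory Defs
  imports "HOL-Analysis.Analysis"
begin

definition Staeckel_compact :: "'a topology \<Rightarrow> bool" where
  "Staeckel_compact X \<longleftrightarrow>
     Hausdorff_space X \<and>
     (\<exists>r. linear_order_on (topspace X) r \<and>
        (\<forall>C. closedin X C \<and> C \<noteq> {} \<longrightarrow>
           (\<exists>a\<in>C. \<forall>x\<in>C. (a, x) \<in> r) \<and>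
           (\<exists>b\<in>C. \<forall>x\<in>C. (x, b) \<in> r)))"

text \<open>
  A countable ordinal is an isomorphism class of well-orders of countable sets. Up to isomorphism
  the field of such a well-order is a set of natural numbers (possibly finite or empty), so
  relations on \<^typ>\<open>nat\<close> suffice as representatives. The relation \<^const>\<open>ordIso\<close> holds only
  between relations that well-order their fields, hence the partial quotient.
\<close>

definition ord_eq :: "nat rel \<Rightarrow> nat rel \<Rightarrow> bool" where
  "ord_eq r s \<longleftrightarrow> (r, s) \<in> ordIso"

lemma part_equivp_ord_eq: "part_equivp ord_eq"
proof (rule part_equivpI)
  have "Well_order ({} :: nat rel)"
    by simp
  then show "\<exists>r. ord_eq r r"
    unfolding ord_eq_def using ordIso_reflexive by blast
  show "symp ord_eq"
    unfolding ord_eq_def by (blast intro: sympI ordIso_symmetric)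
  show "transp ord_eq"
    unfolding ord_eq_def by (blast intro: transpI ordIso_transitive)
qed

quotient_type countable_ordinal = "nat rel" / partial: ord_eq
  by (rule part_equivp_ord_eq)

lemma ord_eq_Well_order: "ord_eq r r \<longleftrightarrow> Well_order r"
  unfolding ord_eq_def using ordIso_reflexive ordIso_def by blast

instantiation countable_ordinal :: linorder
begin

lift_definition less_eq_countable_ordinal :: "countable_ordinal \<Rightarrow> countable_ordinal \<Rightarrow> bool"
  is "\<lambda>r s. (r, s) \<in> ordLeq"
  unfolding ord_eq_def
  by (meson ordIso_ordLeq_trans ordIso_symmetric ordLeq_ordIso_trans)

lift_definition less_countable_ordinal :: "countable_ordinal \<Rightarrow> countable_ordinal \<Rightarrow> bool"
  is "\<lambda>r s. (r, s) \<in> ordLess"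
  unfolding ord_eq_def
  by (meson ordIso_ordLess_trans ordIso_symmetric ordLess_ordIso_trans)

instance
proof
  fix x y z :: countable_ordinal
  show "x < y \<longleftrightarrow> x \<le> y \<and> \<not> y \<le> x"
    by transfer
      (use not_ordLeq_iff_ordLess ordLess_imp_ordLeq ord_eq_Well_order in blast)
  show "x \<le> x"
    by transfer (use ordLeq_reflexive ord_eq_Well_order in blast)
  show "x \<le> y \<Longrightarrow> y \<le> z \<Longrightarrow> x \<le> z"
    by transfer (rule ordLeq_transitive)
  show "x \<le> y \<Longrightarrow> y \<le> x \<Longrightarrow> x = y"
    by transfer (simp add: ord_eq_def ordIso_iff_ordLeq)
  show "x \<le> y \<or> y \<le> x"
    by transfer (use ordLeq_total ord_eq_Well_order in blast)
qed

end

instantiation countable_ordinal :: linorder_topology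
begin

definition open_countable_ordinal :: "countable_ordinal set \<Rightarrow> bool" where
  "open_countable_ordinal =
     generate_topology (range (\<lambda>a. {..<a}) \<union> range (\<lambda>a. {a<..}))"

instance
  by standard (rule open_countable_ordinal_def)

end

text \<open>
  The ordinal \<open>\<omega>\<^sub>1\<close> is the set of all countable ordinals, so it is the whole type; its order topology
  is the one that \<^const>\<open>euclidean\<close> picks up from the type class.
\<close>

abbreviation omega1 :: "countable_ordinal topology" where
  "omega1 \<equiv> euclidean"

end

theory Submission
  imports Defs
begin

text \<open>
  Let \<open>S\<close> be a subset of \<open>\<omega>\<^sub>1\<close> such that both \<open>S\<close> and its complement are stationary. Order \<open>\<omega>\<^sub>1\<close> by
  putting \<open>S\<close>, in its natural order, below \<open>- S\<close>, in the reverse of its natural order. If a nonempty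
  closed set \<open>C\<close> meets \<open>S\<close>, its least element in this order is the smallest ordinal in \<open>C \<inter> S\<close>. Otherwise \<open>C\<close> lies in
  \<open>- S\<close>, so it is bounded because \<open>S\<close> is stationary, and its least element is the largest ordinal
  in \<open>C\<close>, which exists because \<open>C\<close> is closed. The greatest element is found in the same way with \<open>S\<close> and
  \<open>- S\<close> exchanged (\<open>Staeckel_compact_if_bistationary\<close>).

  Such an \<open>S\<close> exists because \<open>\<omega>\<^sub>1\<close> injects into the power set of a countable set
  (\<open>ex_bistationary\<close>). Let \<open>f\<close> be the injection. If no coordinate set \<open>{x. i \<in> f x}\<close> were as required,
  then each of them would contain, or be disjoint from, a closed unbounded set \<open>C i\<close>. The countably many sets
  \<open>C i\<close> have unboundedly many common elements (\<open>Inter_clubs_unbounded\<close>), and \<open>f\<close> would take the same value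
  at all of them. For countable ordinals, choosing a representing well-order on the natural numbers
  is an injection of this kind.

  The remaining facts about \<open>\<omega>\<^sub>1\<close> are that it is well-ordered and that its countable subsets
  are bounded; the latter follows from Burali-Forti's argument. Since \<open>\<omega>\<^sub>1\<close> has no largest
  element, it is not compact.
\<close>

section \<open>Closed unbounded and stationary sets\<close>

text \<open>
  Closed unbounded sets. Unboundedness is taken in the strict sense; it is the same as the usual one
  when there is no largest element.
\<close>

definition club :: "'a::linorder_topology set \<Rightarrow> bool" where
  "club C \<longleftrightarrow> closed C \<and> (\<forall>a. \<exists>x\<in>C. a < x)"

text \<open>A set is stationary if it meets every closed unbounded set.\<close>

definition stationary :: "'a::linorder_topology set \<Rightarrow> bool" where
  "stationary S \<longleftrightarrow> (\<forall>C. club C \<longrightarrow> C \<inter> S \<noteq> {})"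

lemma closed_contains_lub:
  fixes C :: "'a::linorder_topology set"
  assumes "closed C" "D \<subseteq> C" "D \<noteq> {}"
    and ub: "\<And>d. d \<in> D \<Longrightarrow> d \<le> s"
    and least: "\<And>b. b < s \<Longrightarrow> \<exists>d\<in>D. b < d"
  shows "s \<in> C"
proof (rule ccontr)
  assume "s \<notin> C"
  obtain d where d: "d \<in> D" using \<open>D \<noteq> {}\<close> by blast
  with \<open>s \<notin> C\<close> \<open>D \<subseteq> C\<close> ub have "d < s"
    by (metis order_le_less subsetD)
  moreover have "open (- C)" "s \<in> - C" using \<open>closed C\<close> \<open>s \<notin> C\<close> by auto
  ultimately obtain b where b: "b < s" "{b<..s} \<subseteq> - C"
    using open_left by blast
  then obtain d' where "d' \<in> D" "b < d'" using least by blast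
  then show False using b ub \<open>D \<subseteq> C\<close> by fastforce
qed

lemma ex_lub:
  fixes D :: "'a::wellorder set"
  assumes "\<And>d. d \<in> D \<Longrightarrow> d \<le> u"
  obtains s where "\<And>d. d \<in> D \<Longrightarrow> d \<le> s" "\<And>b. b < s \<Longrightarrow> \<exists>d\<in>D. b < d"
proof
  let ?s = "LEAST s. \<forall>d\<in>D. d \<le> s"
  have "\<forall>d\<in>D. d \<le> ?s"
    by (rule LeastI[of _ u]) (use assms in blast)
  then show "\<And>d. d \<in> D \<Longrightarrow> d \<le> ?s" by blast
  show "\<exists>d\<in>D. b < d" if "b < ?s" for b
    using not_less_Least[OF that] by (auto simp: not_le)
qed

lemma closed_not_club_has_greatest:
  fixes C :: "'a::{wellorder, linorder_topology} set"
  assumes "closed C" "C \<noteq> {}" "\<not> club C"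
  shows "\<exists>m\<in>C. \<forall>x\<in>C. x \<le> m"
proof -
  from assms obtain u where "\<And>x. x \<in> C \<Longrightarrow> x \<le> u"
    unfolding club_def by (meson not_le)
  then obtain s where s: "\<And>d. d \<in> C \<Longrightarrow> d \<le> s" "\<And>b. b < s \<Longrightarrow> \<exists>d\<in>C. b < d"
    using ex_lub by blast
  then have "s \<in> C"
    using closed_contains_lub[OF assms(1) subset_refl assms(2)] by blast
  with s(1) show ?thesis by blast
qed

lemma ex_least:
  fixes D :: "'a::wellorder set"
  assumes "D \<noteq> {}"
  shows "\<exists>m\<in>D. \<forall>x\<in>D. m \<le> x"
proof -
  from assms obtain d where "d \<in> D" by blast
  then have "(LEAST x. x \<in> D) \<in> D" by (rule LeastI)
  then show ?thesis using Least_le[of "\<lambda>x. x \<in> D"] by blast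
qed

section \<open>The linear order defined by a bistationary set\<close>

lemma Staeckel_compact_if_bistationary:
  fixes S :: "'a::{wellorder, linorder_topology} set"
  assumes S: "stationary S" "stationary (- S)"
  shows "Staeckel_compact (euclidean :: 'a topology)"
proof -
  \<comment> \<open>all of \<open>S\<close>, increasing, followed by all of \<open>- S\<close>, decreasing\<close>
  define r where
    "r = {(x, y). if x \<in> S then y \<in> S \<longrightarrow> x \<le> y else y \<notin> S \<and> y \<le> x}"
  have "linear_order_on UNIV r"
    unfolding linear_order_on_def partial_order_on_def preorder_on_def r_def
    by (auto simp: refl_on_def total_on_def intro!: transI antisymI split: if_splits)
  moreover have "(\<exists>a\<in>C. \<forall>x\<in>C. (a, x) \<in> r) \<and> (\<exists>b\<in>C. \<forall>x\<in>C. (x, b) \<in> r)"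
    if C: "closed C" "C \<noteq> {}" for C
  proof
    show "\<exists>a\<in>C. \<forall>x\<in>C. (a, x) \<in> r"
    proof (cases "C \<inter> S = {}")
      case True
      then have "\<not> club C" using S(1) unfolding stationary_def by blast
      from closed_not_club_has_greatest[OF C this] True show ?thesis
        unfolding r_def by fastforce
    next
      case False
      from ex_least[OF False] show ?thesis unfolding r_def by fastforce
    qed
    show "\<exists>b\<in>C. \<forall>x\<in>C. (x, b) \<in> r"
    proof (cases "C \<inter> - S = {}")
      case True
      then have "\<not> club C" using S(2) unfolding stationary_def by blast
      from closed_not_club_has_greatest[OF C this] True show ?thesis
        unfolding r_def by fastforce
    next
      case False
      from ex_least[OF False] show ?thesis unfolding r_def by fastforce
    qed
  qed
  moreover have "Hausdorff_space (euclidean :: 'a topology)"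
    unfolding Hausdorff_space_def disjnt_def using hausdorff by (simp, blast)
  ultimately show ?thesis
    unfolding Staeckel_compact_def by auto
qed

section \<open>Existence of a bistationary set\<close>

text \<open>
  An increasing sequence that starts at \<open>a\<close> and visits every \<open>C i\<close> infinitely often has its supremum
  in all of them.
\<close>

lemma Inter_clubs_unbounded:
  fixes C :: "nat \<Rightarrow> 'a::{wellorder, linorder_topology} set"
  assumes bdd: "\<And>D::'a set. countable D \<Longrightarrow> \<exists>b. \<forall>d\<in>D. d < b"
    and club: "\<And>i. club (C i)"
  shows "\<exists>x. a < x \<and> (\<forall>i. x \<in> C i)"
proof -
  have step: "\<exists>y. y \<in> C i \<and> x < y" for i x
    using club[of i] unfolding club_def by blast
  \<comment> \<open>The first component of \<open>prod_decode n\<close> takes every value for infinitely many \<open>n\<close>, so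
    every \<open>C i\<close> is visited infinitely often.\<close>
  define x where "x = rec_nat a (\<lambda>n y. SOME z. z \<in> C (fst (prod_decode n)) \<and> y < z)"
  have x: "x (Suc n) \<in> C (fst (prod_decode n))" "x n < x (Suc n)" for n
    using someI_ex[OF step[where i = "fst (prod_decode n)" and x = "x n"]] by (simp_all add: x_def)
  have mono: "strict_mono x" using x(2) by (simp add: strict_mono_Suc_iff)
  obtain u where "\<forall>d\<in>range x. d < u"
    using bdd[of "range x"] by auto
  then obtain s where s: "\<And>d. d \<in> range x \<Longrightarrow> d \<le> s" "\<And>b. b < s \<Longrightarrow> \<exists>d\<in>range x. b < d"
    using ex_lub[of "range x" u] less_imp_le by blast
  have "s \<in> C i" for i
  proof (rule closed_contains_lub)
    let ?D = "range (\<lambda>k. x (Suc (prod_encode (i, k))))"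
    show "closed (C i)" using club unfolding club_def by blast
    show "?D \<subseteq> C i" using x(1)[of "prod_encode (i, _)"] by auto
    show "?D \<noteq> {}" by simp
    show "d \<le> s" if "d \<in> ?D" for d using that s(1) by blast
    show "\<exists>d\<in>?D. b < d" if b: "b < s" for b
    proof -
      obtain n where "b < x n" using s(2)[OF b] by blast
      also have "x n < x (Suc (prod_encode (i, n)))"
        by (rule strict_monoD[OF mono]) (simp add: le_imp_less_Suc le_prod_encode_2)
      finally show ?thesis by blast
    qed
  qed
  moreover have "a < s"
  proof -
    have "x 0 = a" by (simp add: x_def)
    then show ?thesis using x(2)[of 0] s(1)[of "x (Suc 0)"] by auto
  qed
  ultimately show ?thesis by blast
qed

lemma ex_bistationary:
  fixes f :: "'a::{wellorder, linorder_topology} \<Rightarrow> 'i::countable set"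
  assumes bdd: "\<And>D::'a set. countable D \<Longrightarrow> \<exists>b. \<forall>d\<in>D. d < b"
    and f: "inj f"
  shows "\<exists>S::'a set. stationary S \<and> stationary (- S)"
proof (rule ccontr)
  assume neg: "\<not> ?thesis"
  have "\<exists>C. club C \<and> (C \<subseteq> {x. i \<in> f x} \<or> C \<subseteq> {x. i \<notin> f x})" for i
  proof -
    have "\<not> stationary {x. i \<in> f x} \<or> \<not> stationary (- {x. i \<in> f x})"
      using neg by blast
    then show ?thesis unfolding stationary_def by blast
  qed
  then obtain C where C: "\<And>i. club (C i)"
      "\<And>i. C i \<subseteq> {x. i \<in> f x} \<or> C i \<subseteq> {x. i \<notin> f x}"
    by metis
  have unb: "\<exists>x. a < x \<and> (\<forall>n. x \<in> C (from_nat n))" for a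
    by (rule Inter_clubs_unbounded) (use bdd C(1) in blast)+
  obtain x where x: "\<And>n. x \<in> C (from_nat n)" using unb by blast
  obtain y where y: "x < y" "\<And>n. y \<in> C (from_nat n)" using unb by blast
  have "i \<in> f x \<longleftrightarrow> i \<in> f y" for i
    using C(2)[of i] x[of "to_nat i"] y(2)[of "to_nat i"] by auto
  then have "f x = f y" by blast
  with f y(1) show False by (auto dest: injD)
qed

section \<open>Countable ordinals\<close>

text \<open>A chosen well-order, on a set of natural numbers, that represents a given countable ordinal.\<close>

abbreviation rep :: "countable_ordinal \<Rightarrow> nat rel" where
  "rep \<equiv> rep_countable_ordinal"

lemma Well_order_rep: "Well_order (rep a)"
  by (rule iffD1[OF ord_eq_Well_order Quotient3_rep_reflp[OF Quotient3_countable_ordinal]])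

lemma abs_rep: "abs_countable_ordinal (rep a) = a"
  by (rule Quotient3_abs_rep[OF Quotient3_countable_ordinal])

lemma inj_rep: "inj rep"
  by (rule inj_on_inverseI) (rule abs_rep)

lemma less_iff_rep: "a < b \<longleftrightarrow> (rep a, rep b) \<in> ordLess"
  by (simp add: less_countable_ordinal_def)

lemma abs_less_iff:
  assumes "Well_order r" "Well_order s"
  shows "abs_countable_ordinal r < abs_countable_ordinal s \<longleftrightarrow> (r, s) \<in> ordLess"
  using assms by (simp add: less_countable_ordinal.abs_eq ord_eq_Well_order)

lemma abs_eqI: "(r, s) \<in> ordIso \<Longrightarrow> abs_countable_ordinal r = abs_countable_ordinal s"
  by (rule Quotient3_rel_abs[OF Quotient3_countable_ordinal]) (simp add: ord_eq_def)

instance countable_ordinal :: wellorder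
proof
  fix P :: "countable_ordinal \<Rightarrow> bool" and a :: countable_ordinal
  assume step: "\<And>x. (\<And>y. y < x \<Longrightarrow> P y) \<Longrightarrow> P x"
  have "wf (inv_image ordLess rep)"
    by (rule wf_inv_image[OF wf_ordLess])
  then show "P a"
  proof (induction a rule: wf_induct_rule)
    case (less x)
    show ?case
      by (rule step, rule less) (simp add: less_iff_rep)
  qed
qed

text \<open>
  Every ordinal below \<open>a\<close> is the order type of a proper initial segment of \<open>rep a\<close>, and such segments
  are indexed by natural numbers.
\<close>

lemma countable_lessThan: "countable {..<a::countable_ordinal}"
proof -
  have "b \<in> range (\<lambda>x. abs_countable_ordinal (Restr (rep a) (underS (rep a) x)))" if "b < a" for b
  proof -
    from that obtain x where "(rep b, Restr (rep a) (underS (rep a) x)) \<in> ordIso"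
      using ordLess_iff_ordIso_Restr[OF Well_order_rep Well_order_rep] less_iff_rep by blast
    from abs_eqI[OF this] show ?thesis
      by (simp add: abs_rep)
  qed
  then have "{..<a} \<subseteq> range (\<lambda>x. abs_countable_ordinal (Restr (rep a) (underS (rep a) x)))"
    by blast
  then show ?thesis by (rule countable_subset) simp
qed

text \<open>
  If the set of countable ordinals were countable, its order could be copied to a relation \<open>T\<close> on the
  natural numbers, and the order type of \<open>T\<close> would be a countable ordinal. Mapping \<open>x\<close> to the order
  type of the copy of \<open>{..<x}\<close> is strictly increasing, so it never decreases its argument; but all its
  values lie below the order type of \<open>T\<close>, a contradiction at \<open>x\<close> equal to that order type.
\<close>

lemma uncountable_countable_ordinal: "\<not> countable (UNIV :: countable_ordinal set)"
proof
  assume "countable (UNIV :: countable_ordinal set)"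
  then obtain h :: "countable_ordinal \<Rightarrow> nat" where h: "inj h"
    by (auto simp: countable_def)
  define R :: "countable_ordinal rel" where "R = {(x, y). x \<le> y}"
  have FR: "Field R = UNIV" by (auto simp: R_def Field_def)
  have wR: "Well_order R"
  proof -
    have "R - Id = {(x, y). x < y}" by (auto simp: R_def)
    then have "wf (R - Id)" using wf by simp
    then show ?thesis unfolding FR well_order_on_def
      unfolding linear_order_on_def partial_order_on_def preorder_on_def
      by (auto simp: R_def refl_on_def total_on_def intro!: transI antisymI)
  qed
  define T where "T = dir_image R h"
  have iso: "(R, T) \<in> ordIso" unfolding T_def
    by (rule dir_image_ordIso[OF wR]) (use h in \<open>simp add: FR\<close>)
  have wT: "Well_order T" using iso unfolding ordIso_def by blast
  then interpret T: wo_rel T unfolding wo_rel_def .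
  have T: "(h x, h y) \<in> T \<longleftrightarrow> x \<le> y" for x y
    unfolding T_def dir_image_def R_def using h by (auto dest: injD)
  define t where "t x = abs_countable_ordinal (Restr T (underS T (h x)))" for x
  have wt: "Well_order (Restr T A)" for A by (rule Well_order_Restr[OF wT])
  have below: "t x < abs_countable_ordinal T" for x
  proof -
    have "Field T \<noteq> {}" using T[of x x] by (auto simp: Field_def)
    then show ?thesis unfolding t_def
      by (simp add: abs_less_iff wt wT underS_Restr_ordLess)
  qed
  have mono: "t x < t y" if "x < y" for x y
  proof -
    have "underS T (h x) \<subset> underS T (h y)"
    proof
      show "underS T (h x) \<subseteq> underS T (h y)"
      proof
        fix z assume z: "z \<in> underS T (h x)"
        have xy: "(h x, h y) \<in> T" "(h y, h x) \<notin> T" using T that by auto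
        with z T.TRANS show "z \<in> underS T (h y)"
          unfolding underS_def by (auto dest: transD)
      qed
      show "underS T (h x) \<noteq> underS T (h y)"
        using that T h unfolding underS_def by (auto dest: injD)
    qed
    then show ?thesis unfolding t_def
      using ofilter_subset_ordLess[OF wT T.underS_ofilter T.underS_ofilter]
      by (simp add: abs_less_iff wt)
  qed
  have "x \<le> t x" for x
  proof (induction x rule: less_induct)
    case (less x)
    show ?case
    proof (rule ccontr)
      assume "\<not> x \<le> t x"
      then have "t x < x" by simp
      with less[OF this] mono[OF this] show False by simp
    qed
  qed
  with below show False using not_le by blast
qed

lemma countable_bounded:
  fixes D :: "countable_ordinal set"
  assumes "countable D"
  shows "\<exists>b. \<forall>d\<in>D. d < b"
proof (rule ccontr)
  assume "\<nexists>b. \<forall>d\<in>D. d < b"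
  then have "UNIV = (\<Union>d\<in>D. insert d {..<d})"
    by (auto simp: not_less order_le_less)
  moreover have "countable (\<Union>d\<in>D. insert d {..<d})"
    using assms countable_lessThan by auto
  ultimately show False using uncountable_countable_ordinal by simp
qed

section \<open>Staeckel-compactness of the first uncountable ordinal\<close>

theorem theorem3p5:
  shows "Staeckel_compact omega1 \<and>
    (\<exists>X :: countable_ordinal topology. Staeckel_compact X \<and> \<not> compact_space X)"
proof -
  have "Staeckel_compact omega1"
    using ex_bistationary[OF countable_bounded inj_rep] Staeckel_compact_if_bistationary
    by blast
  moreover have "\<not> compact_space omega1"
  proof
    assume "compact_space omega1"
    then have "compact (UNIV :: countable_ordinal set)"
      by (simp add: compact_space_def)
    then obtain m :: countable_ordinal where "\<And>x. x \<le> m"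
      using compact_attains_sup[of UNIV] by auto
    moreover obtain b where "m < b" using countable_bounded[of "{m}"] by auto
    ultimately show False using not_le by blast
  qed
  ultimately show ?thesis by blast
qed

end
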